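(* Let $G$ be a distance-regular graph with distinct adjacency eigenvalues $\theta_0>\theta_1>\cdots>\theta_d$. Then the $2$-token graph $F_2(G)$ has some (adjacency) eigenvalues $\mu_0>\mu_1>\cdots>\mu_{d-1}$ satisfying $$2\theta_{i+1}\leq \mu_i \leq 2\theta_i,\qquad i=0,\ldots,d-1.$$
   Context: Graphs are finite and simple, and $G$ is connected. For $G=(V,E)$, the $2$-token graph $F_2(G)$ has as vertices the $2$-subsets of $V$, and two $2$-subsets $A,B$ are adjacent if and only if their symmetric difference is a pair $\{a,b\}$ with $a\in A$, $b\in B$ and $\{a,b\}\in E$. *)

theory Defs
  imports
    "Graph_Theory.Pair_Digraph"
    "Graph_Theory.Digraph_Component"
    "Graph_Theory.Shortest_Path"
    "Jordan_Normal_Form.Char_Poly"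
begin

text \<open>
  Finite simple graphs are rendered by the locale \<^locale>\<open>pair_graph\<close>: finite, loop-free and
  symmetric, the arcs being ordered pairs of vertices, so that an edge is a pair of opposite arcs.
\<close>

section \<open>Adjacency matrix\<close>

text \<open>
  A real matrix has rows and columns numbered from 0, so the vertices are listed in some order.
  By \<open>eigenvalue_adjacency_matrix_iff\<close> below, the order does not influence the eigenvalues.
\<close>

definition vertex_list :: "'a pair_pre_digraph \<Rightarrow> 'a list" where
  "vertex_list G = (SOME vs. distinct vs \<and> set vs = pverts G)"

definition adjacency_matrix :: "'a pair_pre_digraph \<Rightarrow> real mat" where
  "adjacency_matrix G = (let vs = vertex_list G; n = length vs in
     mat n n (\<lambda>(i, j). if (vs ! i, vs ! j) \<in> parcs G then 1 else 0))"

lemma vertex_list: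
  assumes "finite (pverts G)"
  shows "distinct (vertex_list G)" "set (vertex_list G) = pverts G"
  using someI_ex[of "\<lambda>vs. distinct vs \<and> set vs = pverts G"] finite_distinct_list[OF assms]
  unfolding vertex_list_def by auto

lemma eigenvalue_adjacency_matrix_iff:
  assumes fin: "finite (pverts G)"
  shows "eigenvalue (adjacency_matrix G) k \<longleftrightarrow>
    (\<exists>f. (\<exists>v\<in>pverts G. f v \<noteq> 0) \<and>
      (\<forall>u\<in>pverts G. (\<Sum>v | v \<in> pverts G \<and> (u, v) \<in> parcs G. f v) = k * f u))"
    (is "?L \<longleftrightarrow> ?R")
proof -
  define vs where "vs = vertex_list G"
  define n where "n = length vs"
  note vs = vertex_list[OF fin, folded vs_def]
  have A: "adjacency_matrix G = mat n n (\<lambda>(i, j). if (vs ! i, vs ! j) \<in> parcs G then 1 else 0)"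
    by (simp add: adjacency_matrix_def Let_def vs_def n_def)
  have bij: "bij_betw ((!) vs) {..<n} (pverts G)"
    using vs bij_betw_nth[of vs "{..<n}" "pverts G"] by (simp add: n_def)
  have all: "(\<forall>u\<in>pverts G. P u) \<longleftrightarrow> (\<forall>i<n. P (vs ! i))" for P
    using vs by (auto simp: n_def all_set_conv_all_nth simp flip: vs(2))
  have row: "(adjacency_matrix G *\<^sub>v vec n (\<lambda>i. f (vs ! i))) $ i =
      (\<Sum>v | v \<in> pverts G \<and> (vs ! i, v) \<in> parcs G. f v)" if "i < n" for f i
  proof -
    have "(adjacency_matrix G *\<^sub>v vec n (\<lambda>i. f (vs ! i))) $ i =
        (\<Sum>j\<in>{..<n}. if (vs ! i, vs ! j) \<in> parcs G then f (vs ! j) else 0)"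
      using that by (auto simp: A scalar_prod_def atLeast0LessThan intro!: sum.cong)
    also have "\<dots> = (\<Sum>v\<in>pverts G. if (vs ! i, v) \<in> parcs G then f v else 0)"
      by (rule sum.reindex_bij_betw[OF bij])
    also have "\<dots> = (\<Sum>v | v \<in> pverts G \<and> (vs ! i, v) \<in> parcs G. f v)"
      using fin by (simp add: sum.inter_filter)
    finally show ?thesis .
  qed
  have dim: "dim_row (adjacency_matrix G) = n"
    by (simp add: A)
  have ev: "eigenvector (adjacency_matrix G) (vec n (\<lambda>i. f (vs ! i))) k \<longleftrightarrow>
      (\<exists>v\<in>pverts G. f v \<noteq> 0) \<and>
      (\<forall>u\<in>pverts G. (\<Sum>v | v \<in> pverts G \<and> (u, v) \<in> parcs G. f v) = k * f u)" for f
  proof -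
    have "vec n (\<lambda>i. f (vs ! i)) = 0\<^sub>v n \<longleftrightarrow> (\<forall>v\<in>pverts G. f v = 0)"
      unfolding all by (auto simp: vec_eq_iff)
    moreover have "adjacency_matrix G *\<^sub>v vec n (\<lambda>i. f (vs ! i)) = k \<cdot>\<^sub>v vec n (\<lambda>i. f (vs ! i)) \<longleftrightarrow>
        (\<forall>u\<in>pverts G. (\<Sum>v | v \<in> pverts G \<and> (u, v) \<in> parcs G. f v) = k * f u)"
      unfolding all using row[of _ f] dim by (auto simp: vec_eq_iff simp del: index_mult_mat_vec)
    ultimately show ?thesis
      unfolding eigenvector_def dim by auto
  qed
  show ?thesis
  proof
    assume ?L
    then obtain w where w: "eigenvector (adjacency_matrix G) w k"
      unfolding eigenvalue_def by blast
    define f where "f v = w $ inv_into {..<n} ((!) vs) v" for v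
    have w_eq: "w = vec n (\<lambda>i. f (vs ! i))"
      using w bij unfolding eigenvector_def dim
      by (auto simp: f_def vec_eq_iff bij_betw_def)
    show ?R
      using w ev[of f] unfolding w_eq[symmetric] by blast
  next
    assume ?R
    then show ?L
      unfolding eigenvalue_def ev[symmetric] by blast
  qed
qed

section \<open>Distance-regular graphs\<close>

definition graph_dist :: "'a pair_pre_digraph \<Rightarrow> 'a \<Rightarrow> 'a \<Rightarrow> ereal" where
  "graph_dist G u v = wf_digraph.\<mu> (with_proj G) (\<lambda>_. 1) u v"

text \<open>
  Connected, with an intersection array: for vertices \<open>u\<close>, \<open>v\<close> at distance \<open>i\<close>, the numbers
  of neighbours of \<open>v\<close> at distance \<open>i + 1\<close> and \<open>i - 1\<close> from \<open>u\<close> depend only on \<open>i\<close>.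
  Distances from \<open>u\<close> are compared as extended reals, so nothing is at distance \<open>0 - 1\<close>.
\<close>

definition distance_regular :: "'a pair_pre_digraph \<Rightarrow> bool" where
  "distance_regular G \<longleftrightarrow>
     pair_graph G \<and> Digraph_Component.connected (with_proj G) \<and>
     (\<exists>b c :: nat \<Rightarrow> nat. \<forall>i. \<forall>u\<in>pverts G. \<forall>v\<in>pverts G. graph_dist G u v = ereal (real i) \<longrightarrow>
        card {w \<in> pverts G. (v, w) \<in> parcs G \<and> graph_dist G u w = ereal (real i + 1)} = b i \<and>
        card {w \<in> pverts G. (v, w) \<in> parcs G \<and> graph_dist G u w = ereal (real i - 1)} = c i)"

section \<open>2-token graphs\<close>

definition token_graph2 :: "'a pair_pre_digraph \<Rightarrow> 'a set pair_pre_digraph" where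
  "token_graph2 G =
     (let V2 = {A. A \<subseteq> pverts G \<and> card A = 2} in
      \<lparr> pverts = V2,
        parcs = {(A, B). A \<in> V2 \<and> B \<in> V2 \<and>
          (\<exists>a\<in>A. \<exists>b\<in>B. sym_diff A B = {a, b} \<and> (a, b) \<in> parcs G)} \<rparr>)"

lemma pair_graph_token_graph2:
  assumes "pair_graph G"
  shows "pair_graph (token_graph2 G)"
proof -
  interpret pair_graph G by fact
  have fin: "finite {A. A \<subseteq> pverts G \<and> card A = 2}"
    using pair_finite_verts by simp
  have sym: "(b, a) \<in> parcs G" if "(a, b) \<in> parcs G" for a b
    using that pair_sym_arcs by (auto simp: symmetric_def sym_def)
  have sub: "parcs (token_graph2 G) \<subseteq>
      {A. A \<subseteq> pverts G \<and> card A = 2} \<times> {A. A \<subseteq> pverts G \<and> card A = 2}"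
    by (auto simp: token_graph2_def Let_def)
  show ?thesis
  proof unfold_locales
    show "finite (pverts (token_graph2 G))"
      using fin by (simp add: token_graph2_def Let_def)
    show "finite (parcs (token_graph2 G))"
      using sub fin by (meson finite_SigmaI finite_subset)
    show "symmetric (with_proj (token_graph2 G))"
      unfolding symmetric_def
    proof (rule symI)
      fix A B assume "(A, B) \<in> arcs_ends (with_proj (token_graph2 G))"
      then have AB: "(A, B) \<in> parcs (token_graph2 G)"
        by simp
      then obtain a b where ab: "a \<in> A" "b \<in> B" "sym_diff A B = {a, b}" "(a, b) \<in> parcs G"
        by (auto simp: token_graph2_def Let_def)
      from ab(3) have "sym_diff B A = {b, a}"
        by blast
      with AB ab sym[OF ab(4)] show "(B, A) \<in> arcs_ends (with_proj (token_graph2 G))"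
        by (simp add: token_graph2_def Let_def) blast
    qed
  qed (auto simp: token_graph2_def Let_def)
qed

end

theory Submission
  imports Defs
begin

text \<open>
  A function \<open>{u, v} \<mapsto> g (dist u v)\<close> on the pairs of vertices is an eigenfunction of the token
  graph for \<open>2 x\<close> as soon as \<open>g\<close>, extended by \<open>g 0 = 0\<close>, is an eigenvector for \<open>x\<close> of the
  intersection matrix of \<open>G\<close> with row and column 0 deleted: moving either token changes
  the distance with the same multiplicities \<open>c\<close>, \<open>a\<close>, \<open>b\<close>, whence the factor 2. The
  eigenvalues of \<open>G\<close> are those of the full tridiagonal intersection matrix. Both spectra are zero
  sets of solutions \<open>q\<close> and \<open>h\<close> of one three-term recurrence. By the Wronskian, at a zero of
  \<open>h (Suc m)\<close> the signs of \<open>q (Suc m)\<close> and \<open>h m\<close> agree; by the Christoffel--Darboux identity,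
  \<open>h m\<close> has the sign of the slope of \<open>h (Suc m)\<close> there, so it alternates between consecutive zeros.
  Hence \<open>q (Suc m)\<close> vanishes strictly between any two consecutive zeros of \<open>h (Suc m)\<close>.
\<close>

section \<open>Interlacing for three-term recurrences\<close>

text \<open>Each step solves row \<open>Suc i\<close> of the tridiagonal eigenvector equation for
  the entry to its right. Row 0 is left to the choice of \<open>s\<close> and
  \<open>t\<close>.\<close>

fun three_term ::
  "(nat \<Rightarrow> real) \<Rightarrow> (nat \<Rightarrow> real) \<Rightarrow> (nat \<Rightarrow> real) \<Rightarrow> real \<Rightarrow> real \<Rightarrow> real \<Rightarrow> nat \<Rightarrow> real"
where
  "three_term a b c s t x 0 = s"
| "three_term a b c s t x (Suc 0) = t"
| "three_term a b c s t x (Suc (Suc i)) =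
     ((x - a (Suc i)) * three_term a b c s t x (Suc i) - c (Suc i) * three_term a b c s t x i) / b (Suc i)"

lemma continuous_on_three_term:
  assumes "continuous_on S t"
  shows "continuous_on S (\<lambda>x. three_term a b c s (t x) x n)"
proof -
  have "continuous_on S (\<lambda>x. three_term a b c s (t x) x n) \<and>
    continuous_on S (\<lambda>x. three_term a b c s (t x) x (Suc n))"
  proof (induction n)
    case (Suc n)
    then show ?case
      unfolding three_term.simps divide_inverse by (intro conjI continuous_intros) auto
  qed (use assms in simp)
  then show ?thesis ..
qed

lemma sign_change_imp_zero:
  fixes f :: "real \<Rightarrow> real"
  assumes "continuous_on {y..z} f" "y < z" "f y * f z < 0"
  shows "\<exists>x. y < x \<and> x < z \<and> f x = 0"
proof -
  have "\<exists>x\<ge>y. x \<le> z \<and> f x = 0"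
    using IVT'[of f y 0 z] IVT2'[of f z 0 y] assms by (auto simp: mult_less_0_iff)
  then obtain x where x: "y \<le> x" "x \<le> z" "f x = 0" by blast
  moreover have "x \<noteq> y" "x \<noteq> z" using assms x by auto
  ultimately show ?thesis by force
qed

locale jacobi_recurrence =
  fixes a b c :: "nat \<Rightarrow> real" and m :: nat
  assumes b_pos: "i \<le> m \<Longrightarrow> 0 < b i"
    and c_pos: "0 < i \<Longrightarrow> i \<le> m \<Longrightarrow> 0 < c i"
begin

text \<open>The second starting value makes row 0 hold too: these are the polynomials of the first
  kind in \<open>x\<close>.\<close>

definition h :: "real \<Rightarrow> nat \<Rightarrow> real" where
  "h x = three_term a b c 1 ((x - a 0) / b 0) x"

text \<open>Polynomials of the second kind: the zero start amounts to deleting row and column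
  0.\<close>

definition q :: "real \<Rightarrow> nat \<Rightarrow> real" where
  "q x = three_term a b c 0 1 x"

text \<open>The diagonal scaling that symmetrises the tridiagonal matrix; for a distance-regular
  graph it is the size of the sphere of radius \<open>i\<close>, up to the diameter.\<close>

definition weight :: "nat \<Rightarrow> real" where
  "weight i = (\<Prod>j<i. b j / c (Suc j))"

lemma h_0 [simp]: "h x 0 = 1"
  by (simp add: h_def)

lemma q_0 [simp]: "q x 0 = 0" and q_1 [simp]: "q x (Suc 0) = 1"
  by (simp_all add: q_def)

lemma b_nz: "i \<le> m \<Longrightarrow> b i \<noteq> 0"
  using b_pos by fastforce

lemma h_1: "b 0 * h x (Suc 0) = x - a 0"
  using b_nz[of 0] by (simp add: h_def)

lemma h_rec: "Suc i \<le> m \<Longrightarrow> b (Suc i) * h x (Suc (Suc i)) = (x - a (Suc i)) * h x (Suc i) - c (Suc i) * h x i"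
  using b_nz[of "Suc i"] by (simp add: h_def)

lemma q_rec: "Suc i \<le> m \<Longrightarrow> b (Suc i) * q x (Suc (Suc i)) = (x - a (Suc i)) * q x (Suc i) - c (Suc i) * q x i"
  using b_nz[of "Suc i"] by (simp add: q_def)

lemma continuous_on_h [continuous_intros]: "continuous_on S (\<lambda>x. h x i)"
  unfolding h_def divide_inverse by (intro continuous_on_three_term continuous_intros)

lemma continuous_on_q [continuous_intros]: "continuous_on S (\<lambda>x. q x i)"
  unfolding q_def by (intro continuous_on_three_term continuous_intros)

lemma weight_0 [simp]: "weight 0 = 1"
  by (simp add: weight_def)

lemma weight_Suc: "Suc i \<le> m \<Longrightarrow> weight (Suc i) * c (Suc i) = weight i * b i"
  using c_pos[of "Suc i"] by (simp add: weight_def)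

lemma weight_pos: "i \<le> m \<Longrightarrow> 0 < weight i"
  unfolding weight_def by (intro prod_pos ballI divide_pos_pos b_pos c_pos) auto

text \<open>Row \<open>Suc i\<close> at \<open>x\<close> and at \<open>y\<close>: the
  \<open>a\<close>-terms cancel, \<open>x - y\<close> brings the new summand, and
  \<open>weight_Suc\<close> turns the \<open>c\<close>-terms into the expression for
  \<open>i\<close>.\<close>

lemma Christoffel_Darboux:
  assumes "i \<le> m"
  shows "weight i * b i * (h x (Suc i) * h y i - h x i * h y (Suc i)) =
    (x - y) * (\<Sum>j\<le>i. weight j * h x j * h y j)"
  using assms
proof (induction i)
  case 0
  show ?case using h_1[of x] h_1[of y] by (simp add: algebra_simps)
next
  case (Suc i)
  let ?k = "Suc i"
  have "weight ?k * b ?k * (h x (Suc ?k) * h y ?k - h x ?k * h y (Suc ?k)) =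
      weight ?k * (b ?k * h x (Suc ?k)) * h y ?k - weight ?k * h x ?k * (b ?k * h y (Suc ?k))"
    by (simp add: algebra_simps)
  also have "\<dots> = (x - y) * (weight ?k * h x ?k * h y ?k) +
      (weight ?k * c ?k) * (h x ?k * h y i - h x i * h y ?k)"
    unfolding h_rec[OF Suc.prems] by (simp add: algebra_simps)
  also have "\<dots> = (x - y) * (\<Sum>j\<le>?k. weight j * h x j * h y j)"
    using Suc unfolding weight_Suc[OF Suc.prems] by (simp add: algebra_simps)
  finally show ?case .
qed

text \<open>Both solutions belong to the same \<open>x\<close>, so the telescoping of
  \<open>Christoffel_Darboux\<close> adds nothing and the value at index 0 persists.\<close>

lemma Wronskian:
  assumes "i \<le> m"
  shows "weight i * b i * (h x i * q x (Suc i) - h x (Suc i) * q x i) = b 0"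
  using assms
proof (induction i)
  case (Suc i)
  let ?k = "Suc i"
  have "weight ?k * b ?k * (h x ?k * q x (Suc ?k) - h x (Suc ?k) * q x ?k) =
      weight ?k * h x ?k * (b ?k * q x (Suc ?k)) - weight ?k * (b ?k * h x (Suc ?k)) * q x ?k"
    by (simp add: algebra_simps)
  also have "\<dots> = (weight ?k * c ?k) * (h x i * q x ?k - h x ?k * q x i)"
    unfolding h_rec[OF Suc.prems] q_rec[OF Suc.prems] by (simp add: algebra_simps)
  also have "\<dots> = b 0"
    using Suc unfolding weight_Suc[OF Suc.prems] by simp
  finally show ?case .
qed simp

lemma h_mult_q_pos:
  assumes "h y (Suc m) = 0"
  shows "0 < h y m * q y (Suc m)"
proof -
  have "weight m * b m * (h y m * q y (Suc m)) = b 0"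
    using Wronskian[of m y] assms by simp
  then show ?thesis
    using b_pos[of 0] b_pos[of m] weight_pos[of m] by (metis le0 order_refl zero_less_mult_pos mult_pos_pos)
qed

text \<open>The slope without derivatives: by \<open>Christoffel_Darboux\<close>, dividing
  \<open>h x (Suc m) * h y m\<close> by \<open>x - y\<close> leaves a positive multiple of
  \<open>K x\<close>, and \<open>K\<close> is continuous and positive at \<open>y\<close>.\<close>

lemma h_sign_near_zero:
  assumes "h y (Suc m) = 0"
  shows "\<exists>e>0. \<forall>x. x \<noteq> y \<longrightarrow> \<bar>x - y\<bar> < e \<longrightarrow> 0 < h x (Suc m) * h y m * (x - y)"
proof -
  define K where "K x = (\<Sum>j\<le>m. weight j * h x j * h y j)" for x
  \<comment> \<open>The summand for \<open>j = 0\<close> is 1, the others are nonnegative.\<close>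
  have "0 < (\<Sum>j\<le>m. weight j * (h y j)\<^sup>2)"
    by (rule sum_pos2[of _ 0]) (auto intro!: mult_nonneg_nonneg simp: less_imp_le weight_pos)
  then have "0 < K y"
    by (simp add: K_def power2_eq_square mult.assoc)
  moreover have "continuous_on UNIV K"
    unfolding K_def by (intro continuous_intros)
  then have "isCont K y"
    by (simp add: continuous_on_eq_continuous_at)
  ultimately have "eventually (\<lambda>x. 0 < K x) (at y)"
    by (metis isCont_def order_tendstoD(1))
  then obtain e where e: "e > 0" "\<And>x. x \<noteq> y \<Longrightarrow> \<bar>x - y\<bar> < e \<Longrightarrow> 0 < K x"
    by (auto simp: eventually_at dist_real_def)
  have "0 < h x (Suc m) * h y m * (x - y)" if "x \<noteq> y" "\<bar>x - y\<bar> < e" for x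
  proof -
    have "weight m * b m * (h x (Suc m) * h y m) = (x - y) * K x"
      using Christoffel_Darboux[of m x y] assms by (simp add: K_def)
    then have "weight m * b m * (h x (Suc m) * h y m * (x - y)) = (x - y)\<^sup>2 * K x"
      by (metis mult.assoc mult.commute power2_eq_square)
    moreover have "0 < (x - y)\<^sup>2 * K x"
      using e that by simp
    ultimately show ?thesis
      using b_pos[of m] weight_pos[of m] by (metis order_refl zero_less_mult_pos mult_pos_pos)
  qed
  with e show ?thesis by blast
qed

lemma zero_of_q_between_zeros_of_h:
  assumes "y < z" "h y (Suc m) = 0" "h z (Suc m) = 0"
    and consecutive: "\<And>x. y < x \<Longrightarrow> x < z \<Longrightarrow> h x (Suc m) \<noteq> 0"
  shows "\<exists>x. y < x \<and> x < z \<and> q x (Suc m) = 0"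
proof -
  \<comment> \<open>With equal signs, \<open>h x (Suc m)\<close> would leave \<open>y\<close> and
    reach \<open>z\<close> with opposite signs, forcing a zero in between.\<close>
  have "h y m * h z m < 0"
  proof (rule ccontr)
    assume "\<not> h y m * h z m < 0"
    then have same: "0 < h y m * h z m"
      using h_mult_q_pos[OF assms(2)] h_mult_q_pos[OF assms(3)] by (auto simp: zero_less_mult_iff mult_less_0_iff)
    obtain e where e: "e > 0" "\<And>x. x \<noteq> y \<Longrightarrow> \<bar>x - y\<bar> < e \<Longrightarrow> 0 < h x (Suc m) * h y m * (x - y)"
      using h_sign_near_zero[OF assms(2)] by blast
    obtain e' where e': "e' > 0" "\<And>x. x \<noteq> z \<Longrightarrow> \<bar>x - z\<bar> < e' \<Longrightarrow> 0 < h x (Suc m) * h z m * (x - z)"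
      using h_sign_near_zero[OF assms(3)] by blast
    \<comment> \<open>A third of the minimum keeps \<open>y + r\<close> left of
      \<open>z - r\<close>, with both points inside their neighbourhoods.\<close>
    define r where "r = min (min e e') (z - y) / 3"
    have r: "0 < r" "r < e" "r < e'" "y + r < z - r"
      using e(1) e'(1) assms(1) by (auto simp: r_def min_def field_simps)
    have "0 < h (y + r) (Suc m) * h y m" "h (z - r) (Suc m) * h z m < 0"
      using e(2)[of "y + r"] e'(2)[of "z - r"] r by (auto simp: zero_less_mult_iff mult_less_0_iff)
    with same have "h (y + r) (Suc m) * h (z - r) (Suc m) < 0"
      by (auto simp: zero_less_mult_iff mult_less_0_iff)
    then obtain x where "y + r < x" "x < z - r" "h x (Suc m) = 0"
      using sign_change_imp_zero[of "y + r" "z - r" "\<lambda>x. h x (Suc m)"] r continuous_on_h by blast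
    with consecutive[of x] r show False by simp
  qed
  then have "q y (Suc m) * q z (Suc m) < 0"
    using h_mult_q_pos[OF assms(2)] h_mult_q_pos[OF assms(3)]
    by (auto simp: zero_less_mult_iff mult_less_0_iff)
  then show ?thesis
    using sign_change_imp_zero[of y z "\<lambda>x. q x (Suc m)"] assms(1) continuous_on_q by blast
qed

end
section \<open>Distances and the intersection array\<close>

text \<open>\<open>connected\<close> speaks of the symmetric closure, whose reachability is that of
  \<open>G\<close>. A cheapest path therefore exists, and its cost under unit weights is its
  length.\<close>

lemma ex_graph_dist:
  assumes "pair_graph G" "Digraph_Component.connected (with_proj G)"
    and "u \<in> pverts G" "v \<in> pverts G"
  shows "\<exists>n. graph_dist G u v = ereal (real n)"
proof -
  interpret pair_graph G by fact
  have "u \<rightarrow>\<^sup>*\<^bsub>with_proj G\<^esub> v"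
    using assms(2-) reachable_mk_symmetric_eq[OF sym_arcs]
    by (auto simp: connected_def strongly_connected_def)
  then obtain p where "graph_dist G u v = awalk_cost (\<lambda>_. 1) p"
    using min_cost_awalk[of u v "\<lambda>_. 1"] by (auto simp: graph_dist_def)
  then show ?thesis
    by (auto simp: awalk_cost_def sum_list_triv)
qed

locale distance_regular_graph = pair_graph G for G :: "'a pair_pre_digraph" +
  fixes b c :: "nat \<Rightarrow> nat"
  assumes connected_G: "Digraph_Component.connected (with_proj G)"
    and card_b: "\<lbrakk>u \<in> pverts G; v \<in> pverts G; graph_dist G u v = ereal (real i)\<rbrakk> \<Longrightarrow>
      card {w \<in> pverts G. (v, w) \<in> parcs G \<and> graph_dist G u w = ereal (real i + 1)} = b i"
    and card_c: "\<lbrakk>u \<in> pverts G; v \<in> pverts G; graph_dist G u v = ereal (real i)\<rbrakk> \<Longrightarrow>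
      card {w \<in> pverts G. (v, w) \<in> parcs G \<and> graph_dist G u w = ereal (real i - 1)} = c i"
begin

text \<open>A natural number, so that it can index the recurrences; well defined on vertices by
  \<open>ex_graph_dist\<close>.\<close>

definition hop :: "'a \<Rightarrow> 'a \<Rightarrow> nat" where
  "hop u v = (THE n. graph_dist G u v = ereal (real n))"

lemma graph_dist_hop:
  assumes "u \<in> pverts G" "v \<in> pverts G"
  shows "graph_dist G u v = ereal (real (hop u v))"
  using ex_graph_dist[OF pair_graph connected_G assms] by (auto simp: hop_def)

lemma hop_le_length:
  assumes "awalk u p v"
  shows "hop u v \<le> length p"
proof -
  have "graph_dist G u v \<le> ereal (real (length p))"
    using min_cost_le_walk_cost[OF assms, of "\<lambda>_. 1"]
    by (simp add: graph_dist_def awalk_cost_def sum_list_triv)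
  moreover have "u \<in> pverts G" "v \<in> pverts G"
    using assms by auto
  ultimately show ?thesis
    by (simp add: graph_dist_hop)
qed

lemma ex_shortest_awalk:
  assumes "u \<in> pverts G" "v \<in> pverts G"
  shows "\<exists>p. awalk u p v \<and> length p = hop u v"
proof -
  have "u \<rightarrow>\<^sup>*\<^bsub>with_proj G\<^esub> v"
    using assms connected_G reachable_mk_symmetric_eq[OF sym_arcs]
    by (auto simp: connected_def strongly_connected_def)
  then obtain p where "apath u p v" "graph_dist G u v = awalk_cost (\<lambda>_. 1) p"
    using min_cost_awalk[of u v "\<lambda>_. 1"] by (auto simp: graph_dist_def)
  then show ?thesis
    using graph_dist_hop[OF assms] by (auto simp: awalk_cost_def sum_list_triv apath_def)
qed

lemma hop_eq_0_iff [simp]: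
  assumes "u \<in> pverts G" "v \<in> pverts G"
  shows "hop u v = 0 \<longleftrightarrow> u = v"
  using ex_shortest_awalk[OF assms] hop_le_length[of u "[]" v] assms
  by (auto simp: awalk_Nil_iff)

lemma hop_self [simp]: "u \<in> pverts G \<Longrightarrow> hop u u = 0"
  by simp

lemma hop_arc_le:
  assumes "u \<in> pverts G" "(v, w) \<in> parcs G"
  shows "hop u w \<le> Suc (hop u v)"
proof -
  have "v \<in> pverts G" using assms(2) by (rule in_arcsD1)
  then obtain p where p: "awalk u p v" "length p = hop u v"
    using ex_shortest_awalk assms(1) by blast
  moreover have "awalk v [(v, w)] w"
    using assms(2) arc_implies_awalk by fastforce
  ultimately have "awalk u (p @ [(v, w)]) w"
    by (rule_tac awalk_appendI)
  from hop_le_length[OF this] p(2) show ?thesis by simp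
qed

lemma arc_sym: "(v, w) \<in> parcs G \<longleftrightarrow> (w, v) \<in> parcs G"
  using arcs_symmetric by blast

text \<open>Drop the last arc of a shortest walk; \<open>hop_arc_le\<close> excludes a distance
  below \<open>i\<close>.\<close>

lemma hop_predecessor:
  assumes "u \<in> pverts G" "v \<in> pverts G" "hop u v = Suc i"
  shows "\<exists>w\<in>pverts G. (v, w) \<in> parcs G \<and> hop u w = i"
proof -
  obtain p where p: "awalk u p v" "length p = Suc i"
    using ex_shortest_awalk assms by metis
  then obtain p' e where e: "p = p' @ [e]"
    by (metis append_butlast_last_id length_0_conv nat.distinct(1))
  let ?w = "fst e"
  have w: "awalk u p' ?w" "(?w, v) \<in> parcs G"
    using p(1) unfolding e by (auto simp: awalk_simps)
  have "hop u ?w \<le> i"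
    using hop_le_length[OF w(1)] p(2) e by simp
  moreover have "Suc i \<le> Suc (hop u ?w)"
    using hop_arc_le[OF assms(1) w(2)] assms(3) by simp
  ultimately show ?thesis
    using w in_arcsD1 arc_sym by auto
qed

text \<open>Both distances on the right end at \<open>v\<close>, so that \<open>x = v\<close> yields
  \<open>hop v u \<le> hop u v\<close> before symmetry is known. The induction moves
  \<open>v\<close> one step towards \<open>u\<close>.\<close>

lemma hop_triangle:
  assumes "x \<in> pverts G" "u \<in> pverts G" "v \<in> pverts G"
  shows "hop x u \<le> hop x v + hop u v"
  using assms(3)
proof (induction "hop u v" arbitrary: v)
  case 0
  then show ?case using assms by simp
next
  case (Suc n)
  then obtain w where w: "w \<in> pverts G" "(v, w) \<in> parcs G" "hop u w = n"
    using hop_predecessor assms(2) by metis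
  then show ?case
    using Suc.hyps(1)[of w] Suc.hyps(2) hop_arc_le[OF assms(1) w(2)] by simp
qed

lemma hop_commute:
  assumes "u \<in> pverts G" "v \<in> pverts G"
  shows "hop u v = hop v u"
  using hop_triangle[of v u v] hop_triangle[of u v u] assms by (simp add: antisym)

section \<open>Neighbour counts and the rows of the intersection matrix\<close>

definition nbrs :: "'a \<Rightarrow> 'a set" where
  "nbrs v = {w \<in> pverts G. (v, w) \<in> parcs G}"

lemma finite_nbrs [simp]: "finite (nbrs v)"
  using pair_finite_verts by (simp add: nbrs_def)

lemma card_farther_nbrs:
  assumes "u \<in> pverts G" "v \<in> pverts G"
  shows "card {w \<in> nbrs v. hop u w = Suc (hop u v)} = b (hop u v)"
proof -
  have "{w \<in> nbrs v. hop u w = Suc (hop u v)} =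
      {w \<in> pverts G. (v, w) \<in> parcs G \<and> graph_dist G u w = ereal (real (hop u v) + 1)}"
    using assms by (auto simp: nbrs_def graph_dist_hop)
  then show ?thesis using card_b assms by (simp add: graph_dist_hop)
qed

lemma card_closer_nbrs:
  assumes "u \<in> pverts G" "v \<in> pverts G"
  shows "card {w \<in> nbrs v. Suc (hop u w) = hop u v} = c (hop u v)"
proof -
  have "{w \<in> nbrs v. Suc (hop u w) = hop u v} =
      {w \<in> pverts G. (v, w) \<in> parcs G \<and> graph_dist G u w = ereal (real (hop u v) - 1)}"
    using assms by (auto simp: nbrs_def graph_dist_hop)
  then show ?thesis using card_c assms by (simp add: graph_dist_hop)
qed

lemma hop_nbr:
  assumes "v \<in> pverts G" "w \<in> nbrs v"
  shows "hop v w = 1"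
proof -
  have "v \<noteq> w" "hop v w \<le> 1"
    using assms hop_arc_le[of v v w] no_loops' by (auto simp: nbrs_def)
  moreover have "hop v w \<noteq> 0"
    using assms \<open>v \<noteq> w\<close> by (simp add: nbrs_def)
  ultimately show ?thesis by simp
qed

lemma card_nbrs:
  assumes "v \<in> pverts G"
  shows "card (nbrs v) = b 0"
proof -
  have "nbrs v = {w \<in> nbrs v. hop v w = Suc (hop v v)}"
    using assms hop_nbr by auto
  then show ?thesis using card_farther_nbrs[of v v] assms by simp
qed

text \<open>The intersection number counting neighbours at equal distance, with \<open>b 0\<close>
  as the valency.\<close>

definition a :: "nat \<Rightarrow> real" where
  "a i = real (b 0) - real (b i) - real (c i)"

text \<open>The neighbours split into closer, level and farther ones, which gives row
  \<open>i\<close> of the intersection matrix applied to \<open>g\<close>. For \<open>i = 0\<close>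
  the truncated \<open>i - 1\<close> is harmless: no neighbour is closer, so
  \<open>c 0 = 0\<close>.\<close>

lemma sum_nbrs_hop:
  fixes g :: "nat \<Rightarrow> real"
  assumes u: "u \<in> pverts G" and v: "v \<in> pverts G" and i: "hop u v = i"
  shows "(\<Sum>w\<in>nbrs v. g (hop u w)) = c i * g (i - 1) + a i * g i + b i * g (Suc i)"
proof -
  let ?U = "{w \<in> nbrs v. hop u w = Suc i}" and ?D = "{w \<in> nbrs v. Suc (hop u w) = i}"
    and ?E = "{w \<in> nbrs v. hop u w = i}"
  have U: "card ?U = b i" and D: "card ?D = c i"
    using card_farther_nbrs[OF u v] card_closer_nbrs[OF u v] i by auto
  have "hop u w \<le> Suc i" "i \<le> Suc (hop u w)" if "w \<in> nbrs v" for w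
    using that hop_arc_le[OF u, of v w] hop_arc_le[OF u, of w v] arc_sym i by (auto simp: nbrs_def)
  then have N: "nbrs v = (?D \<union> ?E) \<union> ?U"
    by (fastforce simp: le_Suc_eq)
  have split: "sum f (nbrs v) = sum f ?D + sum f ?E + sum f ?U" for f :: "'a \<Rightarrow> real"
    by (subst N, subst sum.union_disjoint, simp, simp, force, subst sum.union_disjoint) auto
  have "real (b 0) = real (card ?D) + real (card ?E) + real (card ?U)"
    using split[of "\<lambda>_. 1"] card_nbrs[OF v] by simp
  then have E: "real (card ?E) = a i"
    using U D by (simp add: a_def)
  have "sum (\<lambda>w. g (hop u w)) ?D = sum (\<lambda>_. g (i - 1)) ?D"
    by (intro sum.cong) auto
  then show ?thesis
    unfolding split using U D E by simp
qed

section \<open>Diameter and positivity of the intersection numbers\<close>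

definition diam :: nat where
  "diam = Max {hop u v |u v. u \<in> pverts G \<and> v \<in> pverts G}"

lemma nonempty: "pverts G \<noteq> {}"
  using connected_G by (auto simp: connected_def strongly_connected_def mk_symmetric_def)

lemma finite_hops: "finite {hop u v |u v. u \<in> pverts G \<and> v \<in> pverts G}"
  using pair_finite_verts by (intro finite_image_set2) auto

lemma hop_le_diam:
  assumes "u \<in> pverts G" "v \<in> pverts G"
  shows "hop u v \<le> diam"
  unfolding diam_def using assms finite_hops by (intro Max_ge) auto

text \<open>Descend from a diametral pair by \<open>hop_predecessor\<close>.\<close>

lemma hop_attained:
  assumes "i \<le> diam"
  shows "\<exists>u\<in>pverts G. \<exists>v\<in>pverts G. hop u v = i"
proof -
  have "diam \<in> {hop u v |u v. u \<in> pverts G \<and> v \<in> pverts G}"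
    unfolding diam_def using nonempty finite_hops by (intro Max_in) auto
  then obtain x y where "x \<in> pverts G" "y \<in> pverts G" "diam = hop x y" by blast
  then have "\<exists>u\<in>pverts G. \<exists>v\<in>pverts G. hop u v = diam"
    by (intro bexI[of _ x] bexI[of _ y]) simp_all
  with assms show ?thesis
  proof (induction rule: inc_induct)
    case (step i)
    then obtain u v where "u \<in> pverts G" "v \<in> pverts G" "hop u v = Suc i" by blast
    then show ?case using hop_predecessor[of u v i] by blast
  qed
qed

text \<open>If \<open>w\<close> precedes \<open>v\<close> on a shortest walk from \<open>u\<close>,
  then \<open>v\<close> is counted at \<open>w\<close>. In \<open>c_pos\<close> the two exchange
  roles.\<close>

lemma b_pos:
  assumes "i < diam"
  shows "0 < b i"
proof -
  obtain u v where uv: "u \<in> pverts G" "v \<in> pverts G" "hop u v = Suc i"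
    using hop_attained[of "Suc i"] assms by auto
  then obtain w where w: "w \<in> pverts G" "(v, w) \<in> parcs G" "hop u w = i"
    using hop_predecessor by blast
  have "v \<in> {x \<in> nbrs w. hop u x = Suc (hop u w)}"
    using uv w arc_sym by (simp add: nbrs_def)
  then have "0 < card {x \<in> nbrs w. hop u x = Suc (hop u w)}"
    by (subst card_gt_0_iff) auto
  then show ?thesis
    using card_farther_nbrs[OF uv(1) w(1)] w by simp
qed

lemma c_pos:
  assumes "0 < i" "i \<le> diam"
  shows "0 < c i"
proof -
  obtain j where j: "i = Suc j"
    using assms(1) gr0_implies_Suc by blast
  obtain u v where uv: "u \<in> pverts G" "v \<in> pverts G" "hop u v = Suc j"
    using hop_attained[OF assms(2)] j by auto
  then obtain w where w: "w \<in> pverts G" "(v, w) \<in> parcs G" "hop u w = j"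
    using hop_predecessor by blast
  have "w \<in> {x \<in> nbrs v. Suc (hop u x) = hop u v}"
    using uv w by (simp add: nbrs_def)
  then have "0 < card {x \<in> nbrs v. Suc (hop u x) = hop u v}"
    by (subst card_gt_0_iff) auto
  then show ?thesis
    using card_closer_nbrs[OF uv(1,2)] uv j by simp
qed

lemma b_diam: "b diam = 0"
proof -
  obtain u v where uv: "u \<in> pverts G" "v \<in> pverts G" "hop u v = diam"
    using hop_attained by blast
  have "hop u w \<noteq> Suc diam" if "w \<in> nbrs v" for w
    using hop_le_diam[OF uv(1), of w] that by (auto simp: nbrs_def)
  then have "{w \<in> nbrs v. hop u w = Suc (hop u v)} = {}"
    using uv by auto
  then show ?thesis using card_farther_nbrs[OF uv(1,2)] uv(3) by (metis card.empty)
qed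

lemma c_0: "c 0 = 0"
proof -
  obtain u where u: "u \<in> pverts G" using nonempty by blast
  then show ?thesis using card_closer_nbrs[of u u] by simp
qed

text \<open>
  Replacing the zero entry \<open>b diam\<close> by 1 turns the last row of the intersection matrix into one
  more step of the recurrence, whose value vanishes exactly if that row is satisfied.
\<close>

sublocale jac: jacobi_recurrence a "(\<lambda>i. real (b i))(diam := 1)" "\<lambda>i. real (c i)" diam
  by unfold_locales (use b_pos c_pos in auto)

text \<open>The true \<open>b diam\<close> is 0 but the recurrence uses 1, so
  \<open>jac.h x (Suc diam)\<close> is exactly the defect of the last row.\<close>

lemma h_row:
  assumes "i \<le> diam"
  shows "c i * jac.h x (i - 1) + a i * jac.h x i + b i * jac.h x (Suc i) =
    x * jac.h x i - (if i = diam then jac.h x (Suc diam) else 0)"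
proof (cases i)
  case 0
  then show ?thesis
    using jac.h_1[of x] c_0 b_diam by (auto simp: algebra_simps split: if_splits)
next
  case (Suc j)
  then show ?thesis
    using jac.h_rec[of j x] assms b_diam by (auto simp: algebra_simps split: if_splits)
qed

text \<open>Row 0, the deleted one, is excluded; the vanishing of \<open>jac.q x (Suc diam)\<close>
  secures the last row.\<close>

lemma q_row:
  assumes "0 < i" "i \<le> diam" "jac.q x (Suc diam) = 0"
  shows "c i * jac.q x (i - 1) + a i * jac.q x i + b i * jac.q x (Suc i) = x * jac.q x i"
proof -
  obtain j where "i = Suc j" using assms(1) gr0_implies_Suc by blast
  then show ?thesis
    using jac.q_rec[of j x] assms b_diam by (auto simp: algebra_simps split: if_splits)
qed

section \<open>Eigenvalues of the graph as zeros of \<open>h\<close>\<close>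

lemma eigenvalue_iff:
  "eigenvalue (adjacency_matrix G) x \<longleftrightarrow>
    (\<exists>f. (\<exists>v\<in>pverts G. f v \<noteq> 0) \<and> (\<forall>u\<in>pverts G. sum f (nbrs u) = x * f u))"
  unfolding eigenvalue_adjacency_matrix_iff[OF pair_finite_verts] nbrs_def ..

lemma sum_nbrs: "sum f (nbrs v) = (\<Sum>w\<in>pverts G. if (v, w) \<in> parcs G then f w else 0)"
  using pair_finite_verts by (simp add: nbrs_def sum.inter_filter)

text \<open>The adjacency operator is self-adjoint: swap the sums and reverse the arcs.\<close>

lemma sum_nbrs_adjoint:
  fixes f g :: "'a \<Rightarrow> real"
  shows "(\<Sum>v\<in>pverts G. sum f (nbrs v) * g v) = (\<Sum>v\<in>pverts G. f v * sum g (nbrs v))"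
proof -
  have "(\<Sum>v\<in>pverts G. sum f (nbrs v) * g v) =
      (\<Sum>v\<in>pverts G. \<Sum>w\<in>pverts G. if (v, w) \<in> parcs G then f w * g v else 0)"
    unfolding sum_nbrs sum_distrib_right by (intro sum.cong) auto
  also have "\<dots> = (\<Sum>w\<in>pverts G. \<Sum>v\<in>pverts G. if (v, w) \<in> parcs G then f w * g v else 0)"
    by (rule sum.swap)
  also have "\<dots> = (\<Sum>v\<in>pverts G. f v * sum g (nbrs v))"
    unfolding sum_nbrs sum_distrib_left using arc_sym by (intro sum.cong) auto
  finally show ?thesis .
qed

lemma eigenvalue_iff_h_eq_0:
  "eigenvalue (adjacency_matrix G) x \<longleftrightarrow> jac.h x (Suc diam) = 0"
proof
  assume zero: "jac.h x (Suc diam) = 0"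
  obtain u where u: "u \<in> pverts G" using nonempty by blast
  \<comment> \<open>A function radial around \<open>u\<close>, with value
    \<open>jac.h x 0 = 1\<close> at \<open>u\<close> itself.\<close>
  let ?f = "\<lambda>v. jac.h x (hop u v)"
  have "sum ?f (nbrs v) = x * ?f v" if "v \<in> pverts G" for v
    using sum_nbrs_hop[OF u that refl, of "jac.h x"] h_row[OF hop_le_diam[OF u that], of x] zero
    by simp
  moreover have "?f u \<noteq> 0" using u by simp
  ultimately show "eigenvalue (adjacency_matrix G) x"
    unfolding eigenvalue_iff using u by (intro exI[of _ ?f] conjI bexI[of _ u]) auto
next
  assume "eigenvalue (adjacency_matrix G) x"
  then obtain f where f0: "\<exists>v\<in>pverts G. f v \<noteq> 0" and f: "\<forall>v\<in>pverts G. sum f (nbrs v) = x * f v"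
    unfolding eigenvalue_iff by (elim exE conjE)
  obtain u where u: "u \<in> pverts G" "f u \<noteq> 0"
    using f0 by blast
  \<comment> \<open>\<open>L g\<close> is the intersection matrix minus \<open>x\<close>, applied to
    \<open>g\<close>. Its radial lift is orthogonal to the eigenfunction \<open>f\<close> by
    self-adjointness.\<close>
  define L where "L g i = c i * g (i - 1) + a i * g i + b i * g (Suc i) - x * g i"
    for g :: "nat \<Rightarrow> real" and i
  have L: "(\<Sum>v\<in>pverts G. f v * L g (hop u v)) = 0" for g
  proof -
    have "f v * L g (hop u v) = f v * (\<Sum>w\<in>nbrs v. g (hop u w)) - x * (f v * g (hop u v))"
      if "v \<in> pverts G" for v
      unfolding sum_nbrs_hop[OF u(1) that refl] by (simp add: L_def algebra_simps)
    then have "(\<Sum>v\<in>pverts G. f v * L g (hop u v)) =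
        (\<Sum>v\<in>pverts G. f v * (\<Sum>w\<in>nbrs v. g (hop u w))) - x * (\<Sum>v\<in>pverts G. f v * g (hop u v))"
      by (simp add: sum_subtractf sum_distrib_left)
    also have "\<dots> = 0"
      using sum_nbrs_adjoint[of f "\<lambda>w. g (hop u w)"] by (simp add: f sum_distrib_left mult.assoc)
    finally show ?thesis .
  qed
  \<comment> \<open>If \<open>h x (Suc diam)\<close> is nonzero, the sum \<open>T i\<close> of \<open>f\<close> over the sphere of radius \<open>i\<close>
    around \<open>u\<close> vanishes for \<open>i = diam\<close>, and the recurrence carries this inwards to \<open>T 0 = f u\<close>.\<close>
  define T where "T i = (\<Sum>v\<in>pverts G. f v * of_bool (hop u v = i))" for i
  show "jac.h x (Suc diam) = 0"
  proof (rule ccontr)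
    assume nz: "jac.h x (Suc diam) \<noteq> 0"
    have "L (jac.h x) (hop u v) = - jac.h x (Suc diam) * of_bool (hop u v = diam)"
      if "v \<in> pverts G" for v
      using h_row[OF hop_le_diam[OF u(1) that], of x] by (simp add: L_def)
    then have "(\<Sum>v\<in>pverts G. f v * L (jac.h x) (hop u v)) = - jac.h x (Suc diam) * T diam"
      unfolding T_def sum_distrib_left by (intro sum.cong) auto
    then have T_diam: "T diam = 0" using nz L by simp
    have T_Suc_diam: "T (Suc diam) = 0"
      unfolding T_def using hop_le_diam[OF u(1)] by (fastforce intro: sum.neutral)
    have "T i = 0 \<and> T (Suc i) = 0" if "i \<le> diam" for i
      using that
    proof (induction rule: inc_induct)
      case (step i)
      \<comment> \<open>Testing with an indicator extracts column \<open>Suc i\<close>, hence a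
        relation between three consecutive \<open>T\<close>, solvable for \<open>T i\<close> as
        \<open>b i\<close> is positive.\<close>
      have "L (\<lambda>j. of_bool (j = Suc i)) j =
          real (c (Suc (Suc i))) * of_bool (j = Suc (Suc i)) + (a (Suc i) - x) * of_bool (j = Suc i) +
          real (b i) * of_bool (j = i)" for j
        by (cases j; cases i) (auto simp: L_def c_0)
      then have "(\<Sum>v\<in>pverts G. f v * L (\<lambda>j. of_bool (j = Suc i)) (hop u v)) =
          c (Suc (Suc i)) * T (Suc (Suc i)) + (a (Suc i) - x) * T (Suc i) + b i * T i"
        unfolding T_def sum_distrib_left sum.distrib[symmetric]
        by (intro sum.cong) (simp_all only: distrib_left mult_ac)
      then have "c (Suc (Suc i)) * T (Suc (Suc i)) + (a (Suc i) - x) * T (Suc i) + b i * T i = 0"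
        unfolding L by simp
      with step b_pos[of i] show ?case by simp
    qed (use T_diam T_Suc_diam in simp)
    then have "T 0 = 0" by simp
    moreover have "T 0 = (\<Sum>v\<in>pverts G. if v = u then f v else 0)"
      unfolding T_def using u by (intro sum.cong) auto
    ultimately show False
      using u pair_finite_verts by simp
  qed
qed

section \<open>Eigenvalues of the 2-token graph\<close>

lemma nbrs_token_graph2:
  assumes uv: "u \<in> pverts G" "v \<in> pverts G" "u \<noteq> v"
  shows "{B \<in> pverts (token_graph2 G). ({u, v}, B) \<in> parcs (token_graph2 G)} =
    (\<lambda>w. {w, v}) ` (nbrs u - {v}) \<union> (\<lambda>w. {u, w}) ` (nbrs v - {u})" (is "?L = ?R")
proof (intro equalityI subsetI)
  fix B assume "B \<in> ?L"
  then obtain a b where B: "B \<subseteq> pverts G" "card B = 2" "a \<in> {u, v}" "b \<in> B"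
      "sym_diff {u, v} B = {a, b}" "(a, b) \<in> parcs G"
    by (auto simp: token_graph2_def Let_def)
  obtain x y where xy: "B = {x, y}" "x \<noteq> y"
    using B(2) by (auto simp: card_2_iff)
  have "a \<noteq> b" using B(6) no_loops' by blast
  \<comment> \<open>\<open>a\<close> is the vertex that a token leaves and \<open>b\<close> the one
    it enters; the other token stays.\<close>
  have "a \<notin> B" "b \<notin> {u, v}"
    using B(3,4,5) \<open>a \<noteq> b\<close> by blast+
  show "B \<in> ?R"
  proof (cases "a = u")
    case True
    then have "v \<notin> sym_diff {u, v} B" using B(5) uv \<open>b \<notin> {u, v}\<close> by auto
    then have "B = {b, v}" using xy B(4) \<open>b \<notin> {u, v}\<close> by auto
    then show ?thesis using True B \<open>b \<notin> {u, v}\<close> by (auto simp: nbrs_def)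
  next
    case False
    then have "a = v" using B(3) by blast
    then have "u \<notin> sym_diff {u, v} B" using B(5) uv \<open>b \<notin> {u, v}\<close> by auto
    then have "B = {u, b}" using xy B(4) \<open>b \<notin> {u, v}\<close> by auto
    then show ?thesis using \<open>a = v\<close> B \<open>b \<notin> {u, v}\<close> by (auto simp: nbrs_def)
  qed
next
  have mem: "{w, z} \<in> pverts (token_graph2 G) \<and> ({y, z}, {w, z}) \<in> parcs (token_graph2 G)"
    if "y \<in> pverts G" "z \<in> pverts G" "y \<noteq> z" "w \<in> nbrs y - {z}" for w y z
  proof -
    have "(y, w) \<in> parcs G" "w \<in> pverts G" "w \<noteq> z" "w \<noteq> y"
      using that no_loops' by (auto simp: nbrs_def)
    moreover have "sym_diff {y, z} {w, z} = {y, w}"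
      using that calculation by auto
    ultimately show ?thesis
      using that by (auto simp: token_graph2_def Let_def)
  qed
  fix B assume "B \<in> ?R"
  then show "B \<in> ?L"
    using mem[of u v] mem[of v u] uv by (auto simp: insert_commute)
qed

lemma eigenvalue_token_graph2:
  assumes "0 < diam" "jac.q x (Suc diam) = 0"
  shows "eigenvalue (adjacency_matrix (token_graph2 G)) (2 * x)"
proof -
  let ?q = "jac.q x"
  \<comment> \<open>The double sum avoids ordering the pair: the diagonal vanishes because
    \<open>?q 0 = 0\<close>, and both orders contribute equally.\<close>
  define f where "f A = (\<Sum>u\<in>A. \<Sum>v\<in>A. ?q (hop u v))" for A
  have f: "f {u, v} = 2 * ?q (hop u v)" if "u \<in> pverts G" "v \<in> pverts G" "u \<noteq> v" for u v
    using that hop_commute[of u v] by (simp add: f_def)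
  interpret T: pair_graph "token_graph2 G"
    using pair_graph by (rule pair_graph_token_graph2)
  have "\<exists>A\<in>pverts (token_graph2 G). f A \<noteq> 0"
  proof -
    obtain u v where uv: "u \<in> pverts G" "v \<in> pverts G" "hop u v = Suc 0"
      using hop_attained[of "Suc 0"] assms(1) by auto
    then have "u \<noteq> v" by auto
    with uv f[of u v] show ?thesis
      by (intro bexI[of _ "{u, v}"]) (auto simp: token_graph2_def Let_def)
  qed
  moreover have "(\<Sum>B | B \<in> pverts (token_graph2 G) \<and> (A, B) \<in> parcs (token_graph2 G). f B) =
      2 * x * f A" if "A \<in> pverts (token_graph2 G)" for A
  proof -
    have A: "A \<subseteq> pverts G" "card A = 2"
      using that by (auto simp: token_graph2_def Let_def)
    then obtain u v where uv: "A = {u, v}" "u \<noteq> v"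
      by (meson card_2_iff)
    then have uv: "A = {u, v}" "u \<in> pverts G" "v \<in> pverts G" "u \<noteq> v"
      using A(1) by auto
    \<comment> \<open>The token at \<open>z\<close> moves while the one at \<open>y\<close> stays;
      each token contributes one such half.\<close>
    have half: "(\<Sum>w\<in>nbrs z - {y}. f {y, w}) = x * f {y, z}"
      if "y \<in> pverts G" "z \<in> pverts G" "y \<noteq> z" for y z
    proof -
      have "(\<Sum>w\<in>nbrs z - {y}. f {y, w}) = (\<Sum>w\<in>nbrs z - {y}. 2 * ?q (hop y w))"
        using that by (intro sum.cong f) (auto simp: nbrs_def)
      \<comment> \<open>The forbidden target \<open>y\<close> may be added, since
        \<open>?q (hop y y) = 0\<close>.\<close>
      also have "\<dots> = (\<Sum>w\<in>nbrs z. 2 * ?q (hop y w))"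
        using that by (intro sum.mono_neutral_left) auto
      also have "\<dots> = 2 * (x * ?q (hop y z))"
      proof -
        have "0 < hop y z" using that hop_eq_0_iff by (metis gr0I)
        then show ?thesis
          using sum_nbrs_hop[OF that(1,2) refl, of ?q] q_row[OF _ hop_le_diam[OF that(1,2)] assms(2)]
          by (simp add: sum_distrib_left[symmetric])
      qed
      finally show ?thesis using f[OF that] by simp
    qed
    \<comment> \<open>A common member \<open>{w, v} = {u, w'}\<close> would force
      \<open>w' = v\<close>, a loop at \<open>v\<close>.\<close>
    have "v \<notin> nbrs v" using no_loops' by (auto simp: nbrs_def)
    then have disj: "(\<lambda>w. {w, v}) ` (nbrs u - {v}) \<inter> (\<lambda>w. {u, w}) ` (nbrs v - {u}) = {}"
      using uv by (auto simp: doubleton_eq_iff)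
    have inj: "inj_on (\<lambda>w. {w, v}) (nbrs u - {v})" "inj_on (\<lambda>w. {u, w}) (nbrs v - {u})"
      by (auto simp: inj_on_def doubleton_eq_iff)
    have "(\<Sum>B | B \<in> pverts (token_graph2 G) \<and> (A, B) \<in> parcs (token_graph2 G). f B) =
        (\<Sum>w\<in>nbrs u - {v}. f {w, v}) + (\<Sum>w\<in>nbrs v - {u}. f {u, w})"
      unfolding uv(1) nbrs_token_graph2[OF uv(2-)]
      by (subst sum.union_disjoint) (use disj in \<open>auto simp: sum.reindex inj\<close>)
    also have "\<dots> = 2 * x * f A"
      using half[of u v] half[of v u] uv by (simp add: insert_commute)
    finally show ?thesis .
  qed
  ultimately show ?thesis
    unfolding eigenvalue_adjacency_matrix_iff[OF T.pair_finite_verts] by (intro exI[of _ f]) blast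
qed

end

theorem corollary5p5:
  fixes G :: "'a pair_pre_digraph" and d :: nat and \<theta> :: "nat \<Rightarrow> real"
  assumes "distance_regular G"
    and "{x. eigenvalue (adjacency_matrix G) x} = \<theta> ` {..d}"
    and "strict_antimono_on {..d} \<theta>"
  shows "\<exists>\<mu> :: nat \<Rightarrow> real.
    (\<forall>i<d. eigenvalue (adjacency_matrix (token_graph2 G)) (\<mu> i)) \<and>
    strict_antimono_on {..<d} \<mu> \<and>
    (\<forall>i<d. 2 * \<theta> (Suc i) \<le> \<mu> i \<and> \<mu> i \<le> 2 * \<theta> i)"
proof -
  obtain b c where "distance_regular_graph G b c"
    using assms(1) unfolding distance_regular_def distance_regular_graph_def
      distance_regular_graph_axioms_def by blast
  then interpret distance_regular_graph G b c .
  have less: "\<theta> j < \<theta> i" if "i < j" "j \<le> d" for i j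
    using assms(3) that by (auto simp: monotone_on_def)
  have zeros: "jac.h x (Suc diam) = 0 \<longleftrightarrow> x \<in> \<theta> ` {..d}" for x
    using assms(2) eigenvalue_iff_h_eq_0[of x] by blast
  \<comment> \<open>\<open>\<theta> (Suc i)\<close> and \<open>\<theta> i\<close> are consecutive
    zeros of \<open>h\<close>, so a zero of \<open>q\<close> separates them strictly.\<close>
  have "\<exists>x. \<theta> (Suc i) < x \<and> x < \<theta> i \<and> eigenvalue (adjacency_matrix (token_graph2 G)) (2 * x)"
    if "i < d" for i
  proof -
    have ends: "jac.h (\<theta> (Suc i)) (Suc diam) = 0" "jac.h (\<theta> i) (Suc diam) = 0"
      using that by (auto simp: zeros)
    have "\<theta> (Suc i) < \<theta> i" using less that by simp
    moreover have "jac.h x (Suc diam) \<noteq> 0" if x: "\<theta> (Suc i) < x" "x < \<theta> i" for x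
    proof
      assume "jac.h x (Suc diam) = 0"
      then obtain j where j: "j \<le> d" "x = \<theta> j" by (auto simp: zeros)
      consider "j < i" | "j = i" | "j = Suc i" | "Suc i < j" by linarith
      then show False
        using x j less[of j i] less[of "Suc i" j] \<open>i < d\<close> by cases auto
    qed
    ultimately obtain x where x: "\<theta> (Suc i) < x" "x < \<theta> i" "jac.q x (Suc diam) = 0"
      using jac.zero_of_q_between_zeros_of_h ends by blast
    moreover have "0 < diam"
    proof (rule ccontr)
      assume "\<not> 0 < diam"
      then have "diam = 0" by simp
      with x(3) jac.q_1[of x] show False by (metis zero_neq_one)
    qed
    ultimately show ?thesis using eigenvalue_token_graph2 by blast
  qed
  then obtain \<nu> where \<nu>: "\<And>i. i < d \<Longrightarrow> \<theta> (Suc i) < \<nu> i \<and> \<nu> i < \<theta> i \<and>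
      eigenvalue (adjacency_matrix (token_graph2 G)) (2 * \<nu> i)"
    by metis
  \<comment> \<open>The open intervals containing the \<open>\<nu> i\<close> are disjoint and
    descend with \<open>i\<close>.\<close>
  have "\<nu> j < \<nu> i" if "i < j" "j < d" for i j
  proof -
    have "\<nu> j < \<theta> j" "\<theta> (Suc i) < \<nu> i"
      using \<nu> that by auto
    moreover have "\<theta> j \<le> \<theta> (Suc i)"
      using less[of "Suc i" j] that by (cases "j = Suc i") auto
    ultimately show ?thesis by simp
  qed
  then show ?thesis
    using \<nu> by (intro exI[of _ "\<lambda>i. 2 * \<nu> i"]) (auto simp: monotone_on_def less_imp_le)
qed

end
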